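(* Let $d\ge 1$. Let $f:[0,\infty)\to\mathbb{R}$ be a function such that its radial extension $F:\mathbb{R}^d\to\mathbb{R}$, $F(x)=f(|x|)$, belongs to the set $\mathcal{A}$ and satisfies $A(F)A(\widehat F)=\mathbf{A}^2$. Then $f$ has infinitely many double roots in the interval $(A(F),\infty)$.
   Context: The Fourier transform on $\mathbb{R}^d$ is normalized by $\widehat F(y)=\int_{\mathbb{R}^d} F(x)e^{-2\pi i x\cdot y}\,dx$. For a real-valued function $g$ on $\mathbb{R}^d$, $A(g):=\inf\{r>0:\ g(x)\ge 0\text{ for all }|x|>r\}\in[0,\infty]$ (with $A(g)=\infty$ if no such $r$ exists). Let $\mathcal{A}$ denote the set of nonzero, even, integrable functions $g:\mathbb{R}^d\to\mathbb{R}$ with integrable Fourier transform such that $g(0)\le 0$ and $\widehat g(0)\le 0$. (Evenness makes $\widehat g$ real-valued; integrable functions with integrable Fourier transform are identified with their continuous representatives, so members of $\mathcal{A}$ are continuous.) Set $\mathbf{A}:=\inf_{g\in\mathcal{A}}\sqrt{A(g)A(\widehat g)}$. A continuous function $f$ has a double root at a point $x_0$ if $f(x_0)=0$ and $f$ does not change sign in a neighborhood of $x_0$. *)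

theory Defs
  imports "HOL-Analysis.Analysis"
begin

definition fourier :: "(real ^ 'd \<Rightarrow> real) \<Rightarrow> real ^ 'd \<Rightarrow> complex" where
  "fourier g y =
     (LINT x|lborel. complex_of_real (g x) * exp (- 2 * complex_of_real pi * \<i> * complex_of_real (x \<bullet> y)))"

(* The Fourier transform as a real-valued function; see fourier_even below. *)
definition fourier_real :: "(real ^ 'd \<Rightarrow> real) \<Rightarrow> real ^ 'd \<Rightarrow> real" where
  "fourier_real g y = Re (fourier g y)"

(* A(g); the infimum of the empty set in ennreal is top. *)
definition sign_radius :: "(real ^ 'd \<Rightarrow> real) \<Rightarrow> ennreal" where
  "sign_radius g = (INF r \<in> {r. 0 < r \<and> (\<forall>x. norm x > r \<longrightarrow> 0 \<le> g x)}. ennreal r)"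

(* Members are the continuous representatives of their almost-everywhere classes, so
   nonvanishing can be stated pointwise. *)
definition uncertainty_class :: "(real ^ 'd \<Rightarrow> real) set" where
  "uncertainty_class = {g. continuous_on UNIV g \<and> (\<exists>x. g x \<noteq> 0) \<and> (\<forall>x. g (- x) = g x) \<and>
     integrable lborel g \<and> integrable lborel (fourier g) \<and>
     g 0 \<le> 0 \<and> fourier_real g 0 \<le> 0}"

definition ennreal_sqrt :: "ennreal \<Rightarrow> ennreal" where
  "ennreal_sqrt x = (if x = top then top else ennreal (sqrt (enn2real x)))"

(* The infimum runs over functions on R^d, so the dimension is passed as a type argument.
   The convention 0 * top = 0 plays no role: sign_radius g and sign_radius (fourier_real g)
   are positive for g in this class. *)
definition uncertainty_const :: "'d::finite itself \<Rightarrow> ennreal" where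
  "uncertainty_const _ =
     (INF g \<in> (uncertainty_class :: (real ^ 'd \<Rightarrow> real) set).
        ennreal_sqrt (sign_radius g * sign_radius (fourier_real g)))"

definition double_root :: "(real \<Rightarrow> real) \<Rightarrow> real \<Rightarrow> bool" where
  "double_root f x0 \<longleftrightarrow>
     f x0 = 0 \<and> ((\<forall>\<^sub>F x in nhds x0. 0 \<le> f x) \<or> (\<forall>\<^sub>F x in nhds x0. f x \<le> 0))"

lemma fourier_even:
  fixes g :: "real ^ 'd \<Rightarrow> real"
  assumes "integrable lborel g" and even: "\<And>x. g (- x) = g x"
  shows "fourier g y = complex_of_real (fourier_real g y)"
proof -
  define h where "h = (\<lambda>x. complex_of_real (g x) *
    exp (- 2 * complex_of_real pi * \<i> * complex_of_real (x \<bullet> y)))"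
  have refl: "distr lborel borel uminus = (lborel :: (real ^ 'd) measure)"
    using lborel_affine[of "-1 :: real" "0 :: real ^ 'd"] by (simp add: density_1)
  have [measurable]: "g \<in> borel_measurable borel"
    using borel_measurable_integrable[OF assms(1)] by simp
  have [measurable]: "h \<in> borel_measurable borel"
    unfolding h_def by measurable
  have "cnj (fourier g y) = (LINT x|lborel. cnj (h x))"
    unfolding fourier_def h_def by (rule Bochner_Integration.integral_cnj[symmetric])
  also have "\<dots> = (LINT x|lborel. h (- x))"
    by (simp add: h_def even exp_cnj)
  also have "\<dots> = (LINT x|distr lborel borel uminus. h x)"
    by (rule integral_distr[symmetric]) auto
  also have "\<dots> = fourier g y"
    unfolding refl by (simp add: fourier_def h_def)
  finally show ?thesis
    unfolding fourier_real_def by (simp add: complex_eq_iff)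
qed

end

theory Submission
  imports Defs "HOL-Probability.Characteristic_Functions"
begin

text \<open>
Beyond its sign radius \<open>f\<close> is nonnegative, so every zero of \<open>f\<close> there is a double root. It must be shown
that there are infinitely many such zeros, and the idea is that an extremizer with only finitely many of
them could be improved by a small perturbation.

A dilation and Fourier inversion (\<open>fourier_inversion\<close>) reduce to the case in which \<open>F\<close> and its transform
are nonnegative outside the same ball, whose radius \<open>R\<close> is the uncertainty constant. Then \<open>G\<close>, the sum
of \<open>F\<close> and its transform, is its own Fourier transform, is nonnegative outside the ball, and its zeros
outside the ball are among those of \<open>F\<close>. If these lie on finitely many spheres, the lemma
\<open>self_dual_perturbation\<close> provides a self-dual function \<open>\<psi>\<close> with \<open>\<psi> 0 \<le> 0\<close> that is positive on these
spheres and on the boundary of the ball, and nonnegative near infinity. For small \<open>\<epsilon>\<close> the function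
\<open>G + \<epsilon> * \<psi>\<close> belongs to the uncertainty class and is nonnegative outside a strictly smaller ball
(\<open>uncertainty_const_less_if_finitely_many_zeros\<close>), which contradicts the choice of \<open>R\<close>.

The function \<open>\<psi>\<close> is built from Gaussians alone. A function of the form \<open>4 * w * (1 - w)\<close>, with \<open>w\<close> a
Gaussian, vanishes at the origin and attains its maximum 1 exactly on one sphere; its high powers have
small integral, hence uniformly small Fourier transform. Adding such powers and their transforms gives
positivity on the spheres; a fixed Gaussian is then subtracted to correct the sign at the origin, and a
small multiple of a very wide Gaussian is added to correct the sign at infinity.

Two facts about the sign radii make the product in the extremality hypothesis meaningful: they are
positive on the uncertainty class (\<open>sign_radius_pos\<close>), and the uncertainty constant is finite
(\<open>uncertainty_const_finite\<close>), so the two sign radii of an extremizer are finite as well.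
\<close>

section \<open>Elementary properties of the Fourier transform\<close>

lemma cis_fourier_phase:
  "exp (- 2 * complex_of_real pi * \<i> * complex_of_real r) = cis (- 2 * pi * r)"
  by (simp add: cis_conv_exp mult_ac)

lemma integrable_mult_phase:
  assumes "integrable lborel g"
  shows "integrable lborel (\<lambda>x. complex_of_real (g x) *
    exp (- 2 * complex_of_real pi * \<i> * complex_of_real (x \<bullet> (y :: real ^ 'd))))"
proof -
  have [measurable]: "g \<in> borel_measurable borel"
    using borel_measurable_integrable[OF assms] by simp
  show ?thesis
    by (rule Bochner_Integration.integrable_bound[OF assms])
       (auto simp: norm_mult)
qed

lemma norm_fourier_le:
  fixes g :: "real ^ 'd \<Rightarrow> real"
  assumes "integrable lborel g"
  shows "norm (fourier g y) \<le> (LINT x|lborel. \<bar>g x\<bar>)"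
proof -
  have "norm (fourier g y) \<le> (LINT x|lborel. norm (complex_of_real (g x) *
    exp (- 2 * complex_of_real pi * \<i> * complex_of_real (x \<bullet> y))))"
    unfolding fourier_def by (rule integral_norm_bound)
  also have "\<dots> = (LINT x|lborel. \<bar>g x\<bar>)"
    by (intro Bochner_Integration.integral_cong) (auto simp: norm_mult)
  finally show ?thesis .
qed

lemma fourier_real_0: "fourier_real g 0 = (LINT x|lborel. g x)"
  by (simp add: fourier_real_def fourier_def)

lemma fourier_add:
  assumes "integrable lborel g" "integrable lborel h"
  shows "fourier (\<lambda>x. g x + h x) y = fourier g y + fourier h y"
  unfolding fourier_def
  using integrable_mult_phase[OF assms(1), of y] integrable_mult_phase[OF assms(2), of y]
  by (simp add: ring_distribs)

lemma fourier_cmult: "fourier (\<lambda>x. c * g x) y = of_real c * fourier g y"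
  by (simp add: fourier_def mult.assoc)

lemma fourier_real_add:
  "integrable lborel g \<Longrightarrow> integrable lborel h \<Longrightarrow>
   fourier_real (\<lambda>x. g x + h x) y = fourier_real g y + fourier_real h y"
  by (simp add: fourier_real_def fourier_add)

lemma fourier_real_cmult: "fourier_real (\<lambda>x. c * g x) y = c * fourier_real g y"
  by (simp add: fourier_real_def fourier_cmult)

lemma continuous_on_fourier:
  fixes g :: "real ^ 'd \<Rightarrow> real"
  assumes "integrable lborel g"
  shows "continuous_on UNIV (fourier g)"
proof (rule continuous_at_imp_continuous_on, intro ballI, rule continuous_at_sequentiallyI)
  fix y and u :: "nat \<Rightarrow> real ^ 'd"
  assume u: "u \<longlonglongrightarrow> y"
  have [measurable]: "g \<in> borel_measurable borel"
    using borel_measurable_integrable[OF assms] by simp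
  show "(\<lambda>n. fourier g (u n)) \<longlonglongrightarrow> fourier g y"
    unfolding fourier_def
    by (rule integral_dominated_convergence[where w = "\<lambda>x. norm (g x)"])
       (use assms in \<open>auto intro!: tendsto_intros u simp: norm_mult\<close>)
qed

section \<open>Dilations and translations\<close>

lemma lborel_integral_dilate:
  fixes f :: "'a::euclidean_space \<Rightarrow> 'b::{banach, second_countable_topology}"
  assumes "c > 0"
  shows "(LINT x|lborel. f (c *\<^sub>R x)) = (1 / c) ^ DIM('a) *\<^sub>R (LINT x|lborel. f x)"
proof (cases "f \<in> borel_measurable borel")
  case True
  note [measurable] = this
  have "(LINT x|lborel. f x) =
      (LINT x|density (distr lborel borel (\<lambda>x. 0 + c *\<^sub>R x)) (\<lambda>_. \<bar>c\<bar>^DIM('a)). f x)"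
    using lborel_affine[of c "0::'a"] assms by simp
  also have "\<dots> = c ^ DIM('a) *\<^sub>R (LINT x|lborel. f (c *\<^sub>R x))"
    using assms by (simp add: integral_density integral_distr)
  finally show ?thesis
    using assms by (simp add: power_one_over)
next
  case False
  have "\<not> integrable lborel f"
    using False by auto
  moreover have "\<not> integrable lborel (\<lambda>x. f (c *\<^sub>R x))"
  proof
    assume "integrable lborel (\<lambda>x. f (c *\<^sub>R x))"
    then have *: "(\<lambda>x. f (c *\<^sub>R x)) \<in> borel_measurable borel"
      using borel_measurable_integrable by fastforce
    have "(\<lambda>x. f (c *\<^sub>R ((1/c) *\<^sub>R x))) \<in> borel_measurable borel"
      by (rule measurable_compose[OF _ *]) simp
    then show False using False assms by simp
  qed
  ultimately show ?thesis
    by (simp add: not_integrable_integral_eq)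
qed

lemma integrable_dilate:
  fixes f :: "'a::euclidean_space \<Rightarrow> 'b::{banach, second_countable_topology}"
  assumes "c > 0" "integrable lborel f"
  shows "integrable lborel (\<lambda>x. f (c *\<^sub>R x))"
proof -
  have [measurable]: "f \<in> borel_measurable borel"
    using borel_measurable_integrable[OF assms(2)] by simp
  have "integrable (density (distr lborel borel (\<lambda>x. 0 + c *\<^sub>R x)) (\<lambda>_. \<bar>c\<bar>^DIM('a))) f"
    using assms lborel_affine[of c "0::'a"] by simp
  then have "integrable lborel (\<lambda>x. c ^ DIM('a) *\<^sub>R f (c *\<^sub>R x))"
    using assms by (simp add: integrable_density integrable_distr_eq)
  from integrable_scaleR_right[OF this, of "inverse (c ^ DIM('a))"] show ?thesis
    using assms by simp
qed

lemma integrable_translate: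
  fixes f :: "'a::euclidean_space \<Rightarrow> 'b::{banach, second_countable_topology}"
  assumes "integrable lborel f"
  shows "integrable lborel (\<lambda>x. f (a + x))"
proof -
  have [measurable]: "f \<in> borel_measurable borel"
    using borel_measurable_integrable[OF assms] by simp
  have "integrable (distr lborel borel ((+) a)) f"
    using assms by (simp add: lborel_distr_plus)
  then show ?thesis
    by (simp add: integrable_distr_eq)
qed

lemma lborel_integral_translate:
  fixes f :: "'a::euclidean_space \<Rightarrow> 'b::{banach, second_countable_topology}"
  assumes [measurable]: "f \<in> borel_measurable borel"
  shows "(LINT x|lborel. f (a + x)) = (LINT x|lborel. f x)"
proof -
  have "(LINT x|lborel. f x) = (LINT x|distr lborel borel ((+) a). f x)"
    by (simp add: lborel_distr_plus)
  then show ?thesis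
    by (simp add: integral_distr)
qed

lemma fourier_dilate:
  fixes g :: "real ^ 'd \<Rightarrow> real"
  assumes "c > 0"
  shows "fourier (\<lambda>x. g (c *\<^sub>R x)) y = of_real ((1 / c) ^ CARD('d)) * fourier g ((1 / c) *\<^sub>R y)"
proof -
  let ?h = "\<lambda>x. complex_of_real (g x) *
    exp (- 2 * complex_of_real pi * \<i> * complex_of_real (x \<bullet> ((1 / c) *\<^sub>R y)))"
  have "fourier (\<lambda>x. g (c *\<^sub>R x)) y = (LINT x|lborel. ?h (c *\<^sub>R x))"
    unfolding fourier_def using assms by (intro Bochner_Integration.integral_cong) auto
  also have "\<dots> = (1 / c) ^ CARD('d) *\<^sub>R (LINT x|lborel. ?h x)"
    using lborel_integral_dilate[OF assms, of ?h] by simp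
  finally show ?thesis
    by (simp add: fourier_def scaleR_conv_of_real)
qed

lemma fourier_translate:
  fixes g :: "real ^ 'd \<Rightarrow> real"
  assumes [measurable]: "g \<in> borel_measurable borel"
  shows "fourier (\<lambda>x. g (a + x)) y =
    exp (2 * complex_of_real pi * \<i> * complex_of_real (a \<bullet> y)) * fourier g y"
proof -
  let ?h = "\<lambda>x. exp (2 * complex_of_real pi * \<i> * complex_of_real (a \<bullet> y)) * (complex_of_real (g x) *
    exp (- 2 * complex_of_real pi * \<i> * complex_of_real (x \<bullet> y)))"
  have "fourier (\<lambda>x. g (a + x)) y = (LINT x|lborel. ?h (a + x))"
    unfolding fourier_def
    by (intro Bochner_Integration.integral_cong)
       (auto simp: inner_add_left ring_distribs simp flip: exp_add)
  also have "\<dots> = (LINT x|lborel. ?h x)"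
    by (rule lborel_integral_translate) measurable
  finally show ?thesis
    by (simp add: fourier_def)
qed

section \<open>Gaussians\<close>

definition gauss :: "real \<Rightarrow> real ^ 'd \<Rightarrow> real" where
  "gauss t x = exp (- pi * t * (x \<bullet> x))"

lemma gauss_pos: "gauss t x > 0"
  by (simp add: gauss_def)

lemma gauss_le_1: "t \<ge> 0 \<Longrightarrow> gauss t x \<le> 1"
  by (simp add: gauss_def)

lemma gauss_0 [simp]: "gauss t 0 = 1"
  by (simp add: gauss_def)

lemma continuous_on_gauss: "continuous_on UNIV (gauss t)"
  unfolding gauss_def by (intro continuous_intros)

lemma borel_measurable_gauss [measurable]: "gauss t \<in> borel_measurable borel"
  by (rule borel_measurable_continuous_onI[OF continuous_on_gauss])

lemma gauss_dilate: "t > 0 \<Longrightarrow> gauss t x = gauss 1 (sqrt t *\<^sub>R x)"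
  by (simp add: gauss_def)

lemma gauss_mult: "gauss s x * gauss t x = gauss (s + t) x"
  by (simp add: gauss_def exp_add[symmetric] algebra_simps)

text \<open>This is the characteristic function of the standard normal distribution at
\<open>- sqrt (2 * pi) * v\<close>, after the substitution \<open>x = sqrt (2 * pi) * u\<close>.\<close>

lemma gaussian_1D:
  fixes v :: real
  shows "integrable lborel (\<lambda>u. complex_of_real (exp (- pi * u\<^sup>2)) * cis (- 2 * pi * (u * v)))" (is ?A)
    and "(LINT u|lborel. complex_of_real (exp (- pi * u\<^sup>2)) * cis (- 2 * pi * (u * v))) =
      complex_of_real (exp (- pi * v\<^sup>2))" (is ?B)
proof -
  let ?s = "sqrt (2 * pi)"
  let ?f = "\<lambda>x. std_normal_density x *\<^sub>R iexp ((- ?s * v) * x)"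
  have eq: "?s *\<^sub>R ?f (0 + ?s * u) = complex_of_real (exp (- pi * u\<^sup>2)) * cis (- 2 * pi * (u * v))" for u
  proof -
    have "?s * std_normal_density (?s * u) = exp (- pi * u\<^sup>2)"
      by (simp add: std_normal_density_def power_mult_distrib)
    moreover have "- ?s * v * (?s * u) = - 2 * pi * (u * v)"
    proof -
      have "- ?s * v * (?s * u) = - (?s * ?s) * (u * v)"
        by (simp only: mult_ac mult_minus_left mult_minus_right)
      then show ?thesis by simp
    qed
    then have "iexp (- ?s * v * (?s * u)) = cis (- 2 * pi * (u * v))"
      by (simp only: cis_conv_exp)
    ultimately show ?thesis
      by (simp only: add_0 scaleR_scaleR) (simp only: scaleR_conv_of_real)
  qed
  have "integrable lborel std_normal_density"
    by (rule integrable_normal_density) simp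
  then have int: "integrable lborel ?f"
    by (rule Bochner_Integration.integrable_bound) (auto simp: normal_density_nonneg)
  then have "integrable lborel (\<lambda>u. ?f (0 + ?s * u))"
    by (subst lborel_integrable_real_affine_iff) auto
  then have "integrable lborel (\<lambda>u. ?s *\<^sub>R ?f (0 + ?s * u))"
    by (rule integrable_scaleR_right)
  then show ?A by (simp only: eq)
  have "(LINT u|lborel. complex_of_real (exp (- pi * u\<^sup>2)) * cis (- 2 * pi * (u * v))) =
      (LINT u|lborel. ?s *\<^sub>R ?f (0 + ?s * u))"
    by (simp only: eq)
  also have "\<dots> = (LINT x|lborel. ?f x)"
    using lborel_integral_real_affine[of ?s ?f 0] by (simp only: integral_scaleR_right) simp
  also have "\<dots> = char std_normal_distribution (- ?s * v)"
    unfolding char_def by (subst integral_density) (auto simp: normal_density_nonneg)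
  also have "\<dots> = complex_of_real (exp (- pi * v\<^sup>2))"
    by (simp add: char_std_normal_distribution power_mult_distrib)
  finally show ?B .
qed

text \<open>Both the Gaussian and the Fourier phase factor over the coordinates and Lebesgue measure is a product
measure, so the one-dimensional identity can be applied in each coordinate.\<close>

lemma gauss_1_fourier:
  fixes y :: "real ^ 'd"
  shows "integrable lborel (gauss 1 :: real ^ 'd \<Rightarrow> real)" "fourier (gauss 1) y = of_real (gauss 1 y)"
proof -
  let ?g = "\<lambda>b u. complex_of_real (exp (- pi * u\<^sup>2)) * cis (- 2 * pi * (u * (y \<bullet> b)))"
  let ?T = "\<lambda>f. \<Sum>b\<in>Basis. f b *\<^sub>R b :: real ^ 'd"
  let ?h = "\<lambda>x. complex_of_real (gauss 1 x) *
    exp (- 2 * complex_of_real pi * \<i> * complex_of_real (x \<bullet> y))"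
  interpret product_sigma_finite "\<lambda>b::real ^ 'd. lborel :: real measure"
    by standard
  have "?h (?T f) = (\<Prod>b\<in>Basis. ?g b (f b))" for f
  proof -
    have "?T f \<bullet> ?T f = (\<Sum>b\<in>Basis. (f b)\<^sup>2)"
      by (subst euclidean_inner) (simp add: power2_eq_square)
    moreover have "?T f \<bullet> y = (\<Sum>b\<in>Basis. f b * (y \<bullet> b))"
      by (simp only: inner_sum_left inner_scaleR_left) (simp only: inner_commute)
    ultimately show ?thesis
      unfolding gauss_def cis_fourier_phase prod.distrib
      by (simp add: exp_sum sum_distrib_left cis_conv_exp flip: sum_negf exp_of_real)
  qed
  then have eq: "(\<lambda>f. ?h (?T f)) = (\<lambda>f. \<Prod>b\<in>Basis. ?g b (f b))"
    by auto
  have [measurable]: "?T \<in> measurable (\<Pi>\<^sub>M b\<in>Basis. lborel) borel"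
    by measurable
  have [measurable]: "?h \<in> borel_measurable borel"
    by measurable
  have int: "integrable lborel ?h"
  proof (subst lborel_eq, subst integrable_distr_eq)
    show "integrable (\<Pi>\<^sub>M b\<in>Basis. lborel) (\<lambda>f. ?h (?T f))"
      unfolding eq by (rule product_integrable_prod) (use gaussian_1D(1) in auto)
  qed measurable
  have "integrable lborel (\<lambda>x. norm (?h x))"
    using int by (rule integrable_norm)
  then show "integrable lborel (gauss 1 :: real ^ 'd \<Rightarrow> real)"
    by (simp add: norm_mult gauss_pos less_imp_le)
  have "fourier (gauss 1) y = integral\<^sup>L lborel ?h"
    by (simp add: fourier_def)
  also have "\<dots> = (LINT f|(\<Pi>\<^sub>M b\<in>Basis. lborel). ?h (?T f))"
    by (subst lborel_eq, subst integral_distr) auto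
  also have "\<dots> = (\<Prod>b\<in>Basis. LINT u|lborel. ?g b u)"
    by (subst eq, rule product_integral_prod) (use gaussian_1D(1) in auto)
  also have "\<dots> = (\<Prod>b\<in>Basis. complex_of_real (exp (- pi * (y \<bullet> b)\<^sup>2)))"
    by (simp only: gaussian_1D(2))
  also have "\<dots> = of_real (gauss 1 y)"
    unfolding gauss_def
    by (subst euclidean_inner)
       (simp add: exp_sum sum_distrib_left power2_eq_square mult.assoc flip: sum_negf of_real_prod)
  finally show "fourier (gauss 1) y = of_real (gauss 1 y)" .
qed

lemma integrable_gauss:
  assumes "t > 0"
  shows "integrable lborel (gauss t :: real ^ 'd \<Rightarrow> real)"
proof -
  have "(gauss t :: real ^ 'd \<Rightarrow> real) = (\<lambda>x. gauss 1 (sqrt t *\<^sub>R x))"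
    using gauss_dilate[OF assms] by auto
  then show ?thesis
    using integrable_dilate[OF _ gauss_1_fourier(1), of "sqrt t"] assms by simp
qed

text \<open>The Gaussian of parameter \<open>t\<close> is a dilation of the self-dual one, by \<open>sqrt t\<close>.\<close>

lemma fourier_gauss:
  assumes "t > 0"
  shows "fourier (gauss t :: real ^ 'd \<Rightarrow> real) y = of_real ((1 / sqrt t) ^ CARD('d) * gauss (1 / t) y)"
proof -
  have "(gauss t :: real ^ 'd \<Rightarrow> real) = (\<lambda>x. gauss 1 (sqrt t *\<^sub>R x))"
    using gauss_dilate[OF assms] by auto
  then have "fourier (gauss t :: real ^ 'd \<Rightarrow> real) y = fourier (\<lambda>x. gauss 1 (sqrt t *\<^sub>R x)) y"
    by simp
  also have "\<dots> = of_real ((1 / sqrt t) ^ CARD('d)) * of_real (gauss 1 ((1 / sqrt t) *\<^sub>R y))"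
    using assms by (subst fourier_dilate) (simp_all add: gauss_1_fourier)
  also have "gauss 1 ((1 / sqrt t) *\<^sub>R y) = gauss (1 / t) y"
    using assms by (subst (2) gauss_dilate) (simp_all add: real_sqrt_divide)
  finally show ?thesis by simp
qed

section \<open>Fourier inversion\<close>

text \<open>Fubini's theorem: both sides are the double integral of
\<open>g x * h y * exp (- 2 * pi * \<i> * (x \<bullet> y))\<close>.\<close>

lemma fourier_multiplication_formula:
  fixes g h :: "real ^ 'd \<Rightarrow> real"
  assumes g: "integrable lborel g" and h: "integrable lborel h"
  shows "(LINT y|lborel. fourier g y * of_real (h y)) = (LINT x|lborel. of_real (g x) * fourier h x)"
proof -
  let ?e = "\<lambda>x y :: real ^ 'd. exp (- 2 * complex_of_real pi * \<i> * complex_of_real (x \<bullet> y))"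
  let ?f = "\<lambda>x y. of_real (g x) * (of_real (h y) * ?e y x)"
  have [measurable]: "g \<in> borel_measurable borel" "h \<in> borel_measurable borel"
    using borel_measurable_integrable[OF g] borel_measurable_integrable[OF h] by simp_all
  have "integrable (lborel \<Otimes>\<^sub>M lborel) (case_prod ?f)"
  proof (rule lborel_pair.Fubini_integrable)
    have "(\<lambda>x. LINT y|lborel. norm (case_prod ?f (x, y))) =
        (\<lambda>x. \<bar>g x\<bar> * (LINT y|lborel. \<bar>h y\<bar>))"
      by (simp add: norm_mult)
    then show "integrable lborel (\<lambda>x. LINT y|lborel. norm (case_prod ?f (x, y)))"
      using g by simp
    show "AE x in lborel. integrable lborel (\<lambda>y. case_prod ?f (x, y))"
      using integrable_mult_phase[OF h] by auto
  qed measurable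
  then have "(LINT y|lborel. LINT x|lborel. ?f x y) = (LINT x|lborel. LINT y|lborel. ?f x y)"
    by (rule lborel_pair.Fubini_integral)
  moreover have "(LINT x|lborel. ?f x y) = fourier g y * of_real (h y)" for y
    unfolding fourier_def
    by (subst integral_mult_left_zero[symmetric], intro Bochner_Integration.integral_cong)
       (auto simp: inner_commute)
  moreover have "(LINT y|lborel. ?f x y) = of_real (g x) * fourier h x" for x
    by (simp add: fourier_def)
  ultimately show ?thesis by (simp only:)
qed

lemma integral_gauss_1: "(LINT x|lborel. gauss 1 (x :: real ^ 'd)) = 1"
  using gauss_1_fourier(2)[of "0 :: real ^ 'd"]
  by (metis fourier_real_0 fourier_real_def gauss_0 Re_complex_of_real)

text \<open>The kernels are the Fourier transforms of \<open>gauss (1 / m\<^sup>2)\<close> for \<open>m = n + 1\<close>; they have total mass 1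
and concentrate at the origin. A continuous integrable function can be unbounded, so dominated
convergence is applied, after rescaling by \<open>m\<close>, only to the part of \<open>g\<close> inside the unit ball;
outside it the kernels tend to 0 uniformly and the integrability of \<open>g\<close> suffices.\<close>

lemma gauss_approximate_identity:
  fixes g :: "real ^ 'd \<Rightarrow> real"
  assumes g: "integrable lborel g" and cont: "continuous_on UNIV g"
  shows "(\<lambda>n. LINT x|lborel. g x * (real (Suc n) ^ CARD('d) * gauss ((real (Suc n))\<^sup>2) x))
    \<longlonglongrightarrow> g 0"
proof -
  let ?m = "\<lambda>n. real (Suc n)"
  let ?k = "\<lambda>n x :: real ^ 'd. ?m n ^ CARD('d) * gauss ((?m n)\<^sup>2) x"
  let ?g1 = "\<lambda>x. indicat_real (cball 0 1) x * g x"
  let ?g2 = "\<lambda>x. indicat_real (- cball 0 1) x * g x"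
  have [measurable]: "g \<in> borel_measurable borel"
    using borel_measurable_integrable[OF g] by simp
  have g1_meas [measurable]: "?g1 \<in> borel_measurable borel"
    by (intro borel_measurable_times borel_measurable_indicator) auto
  have [measurable]: "?g2 \<in> borel_measurable borel"
    by (intro borel_measurable_times borel_measurable_indicator) auto
  have kint: "integrable lborel (?k n)" for n
    by (intro integrable_mult_right integrable_gauss) simp
  have "\<exists>B. \<forall>x\<in>cball 0 1. \<bar>g x\<bar> \<le> B"
  proof -
    have "compact (g ` cball 0 1)"
      by (intro compact_continuous_image continuous_on_subset[OF cont]) auto
    then show ?thesis
      by (auto dest!: compact_imp_bounded simp: bounded_iff)
  qed
  then obtain B where B: "\<And>x. x \<in> cball 0 1 \<Longrightarrow> \<bar>g x\<bar> \<le> B" by blast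
  then have B0: "B \<ge> 0" using order_trans[OF abs_ge_zero B[of 0]] by simp
  have B1: "\<bar>?g1 x\<bar> \<le> B" for x
    using B[of x] B0 by (auto simp: indicator_def abs_mult)
  have g2k_int: "integrable lborel (\<lambda>x. ?g2 x * ?k n x)" for n
  proof (rule Bochner_Integration.integrable_bound[OF integrable_mult_right[OF g, of "?m n ^ CARD('d)"]])
    show "AE x in lborel. norm (?g2 x * ?k n x) \<le> norm (?m n ^ CARD('d) * g x)"
    proof (rule AE_I2)
      fix x :: "real ^ 'd"
      have "\<bar>?g2 x\<bar> * (?m n ^ CARD('d) * gauss ((?m n)\<^sup>2) x) \<le> \<bar>g x\<bar> * (?m n ^ CARD('d) * 1)"
        by (intro mult_mono gauss_le_1) (auto simp: indicator_def gauss_pos less_imp_le)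
      then show "norm (?g2 x * ?k n x) \<le> norm (?m n ^ CARD('d) * g x)"
        by (simp add: abs_mult gauss_pos less_imp_le mult_ac)
    qed
  qed measurable
  have near: "(\<lambda>n. LINT x|lborel. ?g1 x * ?k n x) \<longlonglongrightarrow> g 0"
  proof -
    have eq: "(LINT x|lborel. ?g1 x * ?k n x) = (LINT x|lborel. ?g1 ((1 / ?m n) *\<^sub>R x) * gauss 1 x)" for n
    proof -
      let ?f = "\<lambda>x. ?g1 ((1 / ?m n) *\<^sub>R x) * gauss 1 x"
      have "?g1 x * ?k n x = ?m n ^ CARD('d) * ?f (?m n *\<^sub>R x)" for x
        by (subst gauss_dilate) (auto simp del: of_nat_Suc)
      then have "(LINT x|lborel. ?g1 x * ?k n x) = ?m n ^ CARD('d) * (LINT x|lborel. ?f (?m n *\<^sub>R x))"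
        by (simp only: integral_mult_right_zero)
      also have "\<dots> = ?m n ^ CARD('d) * ((1 / ?m n) ^ CARD('d) *\<^sub>R (LINT x|lborel. ?f x))"
        using lborel_integral_dilate[of "?m n" ?f] by simp
      also have "\<dots> = (LINT x|lborel. ?f x)"
        by (simp add: power_one_over del: of_nat_Suc)
      finally show ?thesis .
    qed
    have "(\<lambda>n. LINT x|lborel. ?g1 ((1 / ?m n) *\<^sub>R x) * gauss 1 x) \<longlonglongrightarrow>
        (LINT x|lborel. g 0 * gauss 1 (x :: real ^ 'd))"
    proof (rule integral_dominated_convergence[where w = "\<lambda>x. B * gauss 1 x"])
      show "integrable lborel (\<lambda>x. B * gauss 1 (x :: real ^ 'd))"
        by (intro integrable_mult_right integrable_gauss) simp
      show "AE x in lborel. norm (?g1 ((1 / ?m n) *\<^sub>R x) * gauss 1 x) \<le> B * gauss 1 x" for n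
      proof (rule AE_I2)
        fix x :: "real ^ 'd"
        have "norm (a * gauss 1 x) = \<bar>a\<bar> * gauss 1 x" for a
          by (simp add: abs_mult gauss_pos less_imp_le)
        then show "norm (?g1 ((1 / ?m n) *\<^sub>R x) * gauss 1 x) \<le> B * gauss 1 x"
          using B1[of "(1 / ?m n) *\<^sub>R x"] by (simp only: mult_right_mono gauss_pos less_imp_le)
      qed
      have "isCont ?g1 0"
      proof -
        have "isCont g 0"
          using cont by (simp add: continuous_on_eq_continuous_at)
        moreover have "\<forall>\<^sub>F x in nhds 0. ?g1 x = g x"
          by (rule eventually_mono[OF eventually_nhds_in_open[of "ball 0 1" "0 :: real ^ 'd"]])
            (auto simp: indicator_def)
        ultimately show ?thesis
          using isCont_cong[of ?g1 g 0] by simp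
      qed
      moreover have "(\<lambda>n. (1 / ?m n) *\<^sub>R x) \<longlonglongrightarrow> 0" for x :: "real ^ 'd"
        using tendsto_scaleR[OF LIMSEQ_Suc[OF lim_1_over_n] tendsto_const[of x]] by simp
      ultimately have "(\<lambda>n. ?g1 ((1 / ?m n) *\<^sub>R x)) \<longlonglongrightarrow> ?g1 0" for x
        by (rule isCont_tendsto_compose)
      then show "AE x in lborel. (\<lambda>n. ?g1 ((1 / ?m n) *\<^sub>R x) * gauss 1 x) \<longlonglongrightarrow> g 0 * gauss 1 x"
        by (intro AE_I2 tendsto_intros) (simp add: indicator_def)
      have "(\<lambda>x. ?g1 ((1 / ?m n) *\<^sub>R x)) \<in> borel_measurable borel" for n
        by (rule measurable_compose[OF _ g1_meas]) simp
      from borel_measurable_times[OF this borel_measurable_gauss]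
      show "(\<lambda>x. ?g1 ((1 / ?m n) *\<^sub>R x) * gauss 1 x) \<in> borel_measurable lborel" for n
        by (simp only: measurable_lborel2)
    qed simp
    then show ?thesis
      by (simp only: eq integral_mult_right_zero integral_gauss_1 mult_1_right)
  qed
  have far: "(\<lambda>n. LINT x|lborel. ?g2 x * ?k n x) \<longlonglongrightarrow> 0"
  proof (rule Lim_null_comparison)
    let ?c = "\<lambda>n. ?m n ^ CARD('d) / exp (?m n)"
    have bound: "\<bar>?g2 x * ?k n x\<bar> \<le> ?c n * \<bar>g x\<bar>" for n x
    proof (cases "norm x \<le> 1")
      case False
      have "1 \<le> x \<bullet> x"
        using False by (simp add: norm_eq_sqrt_inner)
      have "?m n \<le> pi * (?m n)\<^sup>2 * (x \<bullet> x)"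
      proof -
        have "?m n * 1 \<le> ?m n * ?m n"
          by (intro mult_left_mono) auto
        then have "1 * ?m n * 1 \<le> pi * (?m n)\<^sup>2 * (x \<bullet> x)"
          using \<open>1 \<le> x \<bullet> x\<close> pi_gt3 by (intro mult_mono) (auto simp: power2_eq_square)
        then show ?thesis by simp
      qed
      then have "gauss ((?m n)\<^sup>2) x \<le> exp (- ?m n)"
        by (simp add: gauss_def)
      then have "?k n x \<le> ?c n"
        unfolding divide_inverse exp_minus[symmetric] by (intro mult_left_mono) simp_all
      moreover have "?k n x \<ge> 0"
        by (simp add: gauss_pos less_imp_le)
      moreover have "\<bar>?g2 x * k\<bar> = k * \<bar>g x\<bar>" if "k \<ge> 0" for k
        using that False by (simp add: abs_mult)
      ultimately show ?thesis
        by (simp only: mult_right_mono abs_ge_zero)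
    qed auto
    show "\<forall>\<^sub>F n in sequentially. norm (LINT x|lborel. ?g2 x * ?k n x) \<le> ?c n * (LINT x|lborel. \<bar>g x\<bar>)"
    proof (rule always_eventually, rule allI)
      fix n
      have "norm (LINT x|lborel. ?g2 x * ?k n x) \<le> (LINT x|lborel. ?c n * \<bar>g x\<bar>)"
        by (rule Bochner_Integration.integral_norm_bound_integral)
           (use bound[of _ n] g in \<open>simp_all del: of_nat_Suc add: g2k_int\<close>)
      then show "norm (LINT x|lborel. ?g2 x * ?k n x) \<le> ?c n * (LINT x|lborel. \<bar>g x\<bar>)"
        by simp
    qed
    have "?c \<longlonglongrightarrow> 0"
      by (rule filterlim_compose[OF tendsto_power_div_exp_0])
         (rule filterlim_compose[OF filterlim_real_sequentially filterlim_Suc])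
    from tendsto_mult_right[OF this, of "LINT x|lborel. \<bar>g x\<bar>"]
    show "(\<lambda>n. ?c n * (LINT x|lborel. \<bar>g x\<bar>)) \<longlonglongrightarrow> 0" by simp
  qed
  have "(LINT x|lborel. g x * ?k n x) = (LINT x|lborel. ?g1 x * ?k n x) + (LINT x|lborel. ?g2 x * ?k n x)" for n
  proof (subst Bochner_Integration.integral_add[symmetric])
    show "integrable lborel (\<lambda>x. ?g1 x * ?k n x)"
    proof (rule Bochner_Integration.integrable_bound[OF integrable_mult_right[OF kint[of n], of B]])
      show "AE x in lborel. norm (?g1 x * ?k n x) \<le> norm (B * ?k n x)"
        unfolding norm_mult[of _ "?k n _"] using B1 B0 by (intro AE_I2 mult_right_mono) auto
    qed measurable
    show "integrable lborel (\<lambda>x. ?g2 x * ?k n x)"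
      by (rule g2k_int)
  qed (auto intro!: Bochner_Integration.integral_cong simp: indicator_def)
  then show ?thesis
    using tendsto_add[OF near far] by simp
qed

text \<open>Damping \<open>fourier g\<close> by a wide Gaussian and moving the transform onto the Gaussian by the multiplication
formula turns the integral into the average of \<open>g\<close> against an approximate identity. As the Gaussian
widens, the damped integrals converge to the integral of \<open>fourier g\<close> and the averages to \<open>g 0\<close>.\<close>

lemma fourier_inversion_at_0:
  fixes g :: "real ^ 'd \<Rightarrow> real"
  assumes g: "integrable lborel g" and cont: "continuous_on UNIV g"
    and ghat: "integrable lborel (fourier g)"
  shows "(LINT y|lborel. fourier g y) = of_real (g 0)"
proof (rule LIMSEQ_unique)
  let ?t = "\<lambda>n. 1 / (real (Suc n))\<^sup>2"
  have [measurable]: "fourier g \<in> borel_measurable borel"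
    using borel_measurable_integrable[OF ghat] by simp
  have "(LINT y|lborel. fourier g y * of_real (gauss (?t n) y)) =
      of_real (LINT x|lborel. g x * (real (Suc n) ^ CARD('d) * gauss ((real (Suc n))\<^sup>2) x))" for n
    by (subst fourier_multiplication_formula[OF g integrable_gauss])
       (simp_all add: fourier_gauss real_sqrt_divide flip: of_real_mult integral_complex_of_real)
  then show "(\<lambda>n. LINT y|lborel. fourier g y * of_real (gauss (?t n) y)) \<longlonglongrightarrow> of_real (g 0)"
    using tendsto_of_real[OF gauss_approximate_identity[OF g cont]] by simp
  show "(\<lambda>n. LINT y|lborel. fourier g y * of_real (gauss (?t n) y)) \<longlonglongrightarrow> (LINT y|lborel. fourier g y)"
  proof (rule integral_dominated_convergence[where w = "\<lambda>y. norm (fourier g y)"])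
    have "?t \<longlonglongrightarrow> 0"
      using tendsto_mult[OF LIMSEQ_Suc[OF lim_1_over_n] LIMSEQ_Suc[OF lim_1_over_n[where 'a = real]]]
      by (simp add: power2_eq_square)
    then have "(\<lambda>n. gauss (?t n) y) \<longlonglongrightarrow> exp (- pi * 0 * (y \<bullet> y))" for y :: "real ^ 'd"
      unfolding gauss_def by (intro tendsto_intros)
    then have "(\<lambda>n. fourier g y * of_real (gauss (?t n) y)) \<longlonglongrightarrow> fourier g y * of_real 1" for y
      by (intro tendsto_intros) simp
    then show "AE y in lborel. (\<lambda>n. fourier g y * of_real (gauss (?t n) y)) \<longlonglongrightarrow> fourier g y"
      by simp
    show "AE y in lborel. norm (fourier g y * of_real (gauss (?t n) y)) \<le> norm (fourier g y)" for n
      by (simp add: norm_mult gauss_def mult_left_le)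
  qed (use ghat in auto)
qed

text \<open>Inversion at the origin, applied to the translate of \<open>g\<close> by \<open>x\<close>.\<close>

lemma fourier_inversion:
  fixes g :: "real ^ 'd \<Rightarrow> real"
  assumes g: "integrable lborel g" and cont: "continuous_on UNIV g"
    and ghat: "integrable lborel (fourier g)"
  shows "(LINT y|lborel. exp (2 * complex_of_real pi * \<i> * complex_of_real (x \<bullet> y)) * fourier g y) = of_real (g x)"
proof -
  have [measurable]: "g \<in> borel_measurable borel" "fourier g \<in> borel_measurable borel"
    using borel_measurable_integrable[OF g] borel_measurable_integrable[OF ghat] by simp_all
  have eq: "fourier (\<lambda>z. g (x + z)) = (\<lambda>y. exp (2 * complex_of_real pi * \<i> * complex_of_real (x \<bullet> y)) * fourier g y)"
    by (simp add: fun_eq_iff fourier_translate)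
  have "norm (exp (2 * complex_of_real pi * \<i> * complex_of_real r)) = 1" for r
    by simp
  then have "integrable lborel (fourier (\<lambda>z. g (x + z)))"
    unfolding eq by (intro Bochner_Integration.integrable_bound[OF ghat]) (auto simp: norm_mult)
  moreover have "continuous_on UNIV (\<lambda>z. g (x + z))"
    by (intro continuous_on_compose2[OF cont] continuous_intros) auto
  ultimately have "(LINT y|lborel. fourier (\<lambda>z. g (x + z)) y) = of_real (g (x + 0))"
    by (intro fourier_inversion_at_0 integrable_translate g)
  then show ?thesis by (simp add: eq)
qed

section \<open>Even functions on which the Fourier transform is an involution\<close>

text \<open>These are the conditions in the definition of the uncertainty class that are preserved by linear
combinations; isolating them makes it possible to subtract functions, which the sign conditions forbid.\<close>

definition inversion_class :: "(real ^ 'd \<Rightarrow> real) set" where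
  "inversion_class = {g. continuous_on UNIV g \<and> (\<forall>x. g (- x) = g x) \<and>
     integrable lborel g \<and> integrable lborel (fourier g)}"

lemma inversion_classD:
  assumes "g \<in> inversion_class"
  shows "continuous_on UNIV g" "g (- x) = g x" "integrable lborel g" "integrable lborel (fourier g)"
  using assms by (auto simp: inversion_class_def)

lemma uncertainty_class_iff:
  "g \<in> uncertainty_class \<longleftrightarrow>
   g \<in> inversion_class \<and> (\<exists>x. g x \<noteq> 0) \<and> g 0 \<le> 0 \<and> fourier_real g 0 \<le> 0"
  by (auto simp: uncertainty_class_def inversion_class_def)

lemma fourier_eq_fourier_real:
  assumes "g \<in> inversion_class"
  shows "fourier g = (\<lambda>y. of_real (fourier_real g y))"
  using fourier_even inversion_classD[OF assms] by blast

lemma fourier_fourier_real: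
  assumes "g \<in> inversion_class"
  shows "fourier (fourier_real g) = (\<lambda>x. of_real (g x))"
proof
  fix x
  have "fourier (fourier_real g) x =
      (LINT y|lborel. exp (2 * complex_of_real pi * \<i> * complex_of_real (- x \<bullet> y)) * fourier g y)"
    unfolding fourier_def[of "fourier_real g"] fourier_eq_fourier_real[OF assms]
    by (intro Bochner_Integration.integral_cong) (auto simp: inner_commute)
  also have "\<dots> = of_real (g x)"
    using inversion_classD[OF assms] by (subst fourier_inversion) auto
  finally show "fourier (fourier_real g) x = of_real (g x)" .
qed

lemma fourier_real_fourier_real:
  "g \<in> inversion_class \<Longrightarrow> fourier_real (fourier_real g) = g"
  by (simp add: fourier_real_def[of "fourier_real g"] fourier_fourier_real fun_eq_iff)

lemma fourier_real_minus: "fourier_real g (- y) = fourier_real g y"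
proof -
  have "cnj (fourier g y) = fourier g (- y)"
    unfolding fourier_def
    by (subst Bochner_Integration.integral_cnj[symmetric]) (simp add: exp_cnj)
  then show ?thesis
    unfolding fourier_real_def by (metis cnj.simps(1))
qed

lemma fourier_real_in_inversion_class:
  assumes "g \<in> inversion_class"
  shows "fourier_real g \<in> inversion_class"
proof -
  note g = inversion_classD[OF assms]
  have "continuous_on UNIV (fourier_real g)"
    unfolding fourier_real_def by (intro continuous_intros continuous_on_fourier g)
  moreover have "integrable lborel (fourier_real g)"
    unfolding fourier_real_def using g by simp
  ultimately show ?thesis
    using g by (simp add: inversion_class_def fourier_real_minus fourier_fourier_real assms)
qed

lemma inversion_class_add:
  assumes "g \<in> inversion_class" "h \<in> inversion_class"
  shows "(\<lambda>x. g x + h x) \<in> inversion_class"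
proof -
  note gh = inversion_classD[OF assms(1)] inversion_classD[OF assms(2)]
  have "fourier (\<lambda>x. g x + h x) = (\<lambda>y. fourier g y + fourier h y)"
    by (simp add: fun_eq_iff fourier_add gh)
  then show ?thesis
    using gh by (auto intro!: continuous_intros simp: inversion_class_def)
qed

lemma inversion_class_cmult:
  assumes "g \<in> inversion_class"
  shows "(\<lambda>x. c * g x) \<in> inversion_class"
proof -
  have "fourier (\<lambda>x. c * g x) = (\<lambda>y. of_real c * fourier g y)"
    by (simp add: fun_eq_iff fourier_cmult)
  then show ?thesis
    using inversion_classD[OF assms] by (auto intro!: continuous_intros simp: inversion_class_def)
qed

lemma inversion_class_dilate:
  fixes g :: "real ^ 'd \<Rightarrow> real"
  assumes "c > 0" "g \<in> inversion_class"
  shows "(\<lambda>x. g (c *\<^sub>R x)) \<in> inversion_class"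
proof -
  note g = inversion_classD[OF assms(2)]
  have "fourier (\<lambda>x. g (c *\<^sub>R x)) = (\<lambda>y. of_real ((1 / c) ^ CARD('d)) * fourier g ((1 / c) *\<^sub>R y))"
    using assms(1) by (simp add: fun_eq_iff fourier_dilate)
  moreover have "integrable lborel (\<lambda>y. fourier g ((1 / c) *\<^sub>R y))"
    using assms(1) g by (intro integrable_dilate) auto
  moreover have "continuous_on UNIV (\<lambda>x. g (c *\<^sub>R x))"
    by (intro continuous_on_compose2[OF g(1)] continuous_intros) auto
  ultimately show ?thesis
    using assms(1) g by (simp add: inversion_class_def integrable_dilate)
qed

lemma fourier_real_dilate:
  fixes g :: "real ^ 'd \<Rightarrow> real"
  assumes "c > 0"
  shows "fourier_real (\<lambda>x. g (c *\<^sub>R x)) y = (1 / c) ^ CARD('d) * fourier_real g ((1 / c) *\<^sub>R y)"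
  using assms by (simp add: fourier_real_def fourier_dilate)

text \<open>Since the transform is an involution, it exchanges the two summands.\<close>

lemma fourier_real_symmetrization:
  assumes "g \<in> inversion_class"
  shows "fourier_real (\<lambda>x. g x + fourier_real g x) = (\<lambda>x. g x + fourier_real g x)"
  using assms fourier_real_in_inversion_class[OF assms]
  by (simp add: fun_eq_iff fourier_real_add inversion_classD fourier_real_fourier_real)

lemma uncertainty_class_fourier_real:
  assumes "g \<in> uncertainty_class"
  shows "fourier_real g \<in> uncertainty_class"
proof -
  have W: "g \<in> inversion_class" and nz: "\<exists>x. g x \<noteq> 0"
    using assms by (auto simp: uncertainty_class_iff)
  have "\<exists>y. fourier_real g y \<noteq> 0"
  proof (rule ccontr)
    assume "\<nexists>y. fourier_real g y \<noteq> 0"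
    then have "fourier_real (fourier_real g) x = 0" for x
      by (simp add: fourier_real_def[of "fourier_real g"] fourier_def)
    with nz show False
      by (simp add: fourier_real_fourier_real[OF W])
  qed
  with assms show ?thesis
    by (simp add: uncertainty_class_iff fourier_real_in_inversion_class fourier_real_fourier_real)
qed

section \<open>Sign radii\<close>

lemma nonneg_if_sign_radius_less:
  "sign_radius g < ennreal (norm x) \<Longrightarrow> 0 \<le> g x"
  unfolding sign_radius_def by (auto simp: INF_less_iff ennreal_less_iff)

lemma sign_radius_le:
  assumes "r > 0" "\<And>x. norm x > r \<Longrightarrow> 0 \<le> g x"
  shows "sign_radius g \<le> ennreal r"
  unfolding sign_radius_def using assms by (intro INF_lower) auto

text \<open>If the sign radius vanished, \<open>g\<close> would be nonnegative almost everywhere, while its integral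
\<open>fourier_real g 0\<close> is at most 0; so \<open>g\<close> would vanish almost everywhere, and with it its Fourier
transform and, by inversion, \<open>g\<close> itself.\<close>

lemma sign_radius_pos:
  fixes g :: "real ^ 'd \<Rightarrow> real"
  assumes "g \<in> uncertainty_class"
  shows "0 < sign_radius g"
proof (rule ccontr)
  have W: "g \<in> inversion_class" and nz: "\<exists>x. g x \<noteq> 0" and hat: "fourier_real g 0 \<le> 0"
    using assms by (auto simp: uncertainty_class_iff)
  assume "\<not> 0 < sign_radius g"
  then have "0 \<le> g x" if "x \<noteq> 0" for x
    using nonneg_if_sign_radius_less[of g x] that by simp
  then have nonneg: "AE x in lborel. 0 \<le> g x"
    by (rule eventually_mono[OF AE_lborel_singleton[of "0 :: real ^ 'd"]])
  then have "(LINT x|lborel. g x) = 0"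
    using hat integral_nonneg_AE[OF nonneg] by (simp add: fourier_real_0)
  then have zero: "AE x in lborel. g x = 0"
    using integral_nonneg_eq_0_iff_AE[OF inversion_classD(3)[OF W] nonneg] by simp
  have "fourier g y = 0" for y
    unfolding fourier_def using zero by (intro integral_eq_zero_AE) (auto elim!: eventually_mono)
  then have "fourier_real (fourier_real g) x = 0" for x
    by (simp add: fourier_real_def fourier_def)
  with nz show False
    by (simp add: fourier_real_fourier_real[OF W])
qed

text \<open>For a self-dual function the geometric mean of the two sign radii is the sign radius itself.\<close>

lemma uncertainty_const_le:
  fixes g :: "real ^ 'd \<Rightarrow> real"
  assumes g: "g \<in> uncertainty_class" "fourier_real g = g"
    and r: "r > 0" "\<And>x. norm x > r \<Longrightarrow> 0 \<le> g x"
  shows "uncertainty_const TYPE('d) \<le> ennreal r"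
proof -
  have le: "sign_radius g \<le> ennreal r"
    using r by (rule sign_radius_le)
  then obtain s where s: "s \<ge> 0" "sign_radius g = ennreal s"
    by (cases "sign_radius g") (auto simp: top_unique)
  have "uncertainty_const TYPE('d) \<le> ennreal_sqrt (sign_radius g * sign_radius (fourier_real g))"
    unfolding uncertainty_const_def using g(1) by (rule INF_lower)
  also have "\<dots> = ennreal s"
    using s g(2) by (simp add: ennreal_sqrt_def flip: ennreal_mult)
  finally show ?thesis using le s by simp
qed

section \<open>Linear combinations of Gaussians\<close>

text \<open>The span is closed under products and under the Fourier transform, and all its members decay at a
Gaussian rate. The last property is what allows the behaviour at infinity to be
corrected by one slowly decaying Gaussian.\<close>

inductive_set gaussian_span :: "(real ^ 'd \<Rightarrow> real) set" where
  zero: "(\<lambda>x. 0) \<in> gaussian_span"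
| add_gauss: "p \<in> gaussian_span \<Longrightarrow> t > 0 \<Longrightarrow> (\<lambda>x. p x + c * gauss t x) \<in> gaussian_span"

lemma gaussian_span_gauss: "t > 0 \<Longrightarrow> (\<lambda>x. c * gauss t x) \<in> gaussian_span"
  using gaussian_span.add_gauss[OF gaussian_span.zero, of t c] by simp

lemma gaussian_span_add:
  assumes "p \<in> gaussian_span" "q \<in> gaussian_span"
  shows "(\<lambda>x. p x + q x) \<in> gaussian_span"
  using assms(2)
proof induction
  case zero
  then show ?case using assms(1) by simp
next
  case (add_gauss q t c)
  then show ?case
    using gaussian_span.add_gauss[of "\<lambda>x. p x + q x" t c] by (simp add: add.assoc)
qed

lemma gaussian_span_mult_gauss:
  assumes "p \<in> gaussian_span" "s > 0"
  shows "(\<lambda>x. p x * (c * gauss s x)) \<in> gaussian_span"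
  using assms(1)
proof induction
  case zero
  then show ?case by (simp add: gaussian_span.zero)
next
  case (add_gauss p t b)
  then have "(\<lambda>x. p x * (c * gauss s x) + (b * c) * gauss (t + s) x) \<in> gaussian_span"
    using assms(2) by (intro gaussian_span.add_gauss) auto
  then show ?case
    by (simp add: gauss_mult[symmetric] algebra_simps)
qed

lemma gaussian_span_mult:
  assumes "p \<in> gaussian_span" "q \<in> gaussian_span"
  shows "(\<lambda>x. p x * q x) \<in> gaussian_span"
  using assms(2)
proof induction
  case zero
  then show ?case by (simp add: gaussian_span.zero)
next
  case (add_gauss q t c)
  then show ?case
    using gaussian_span_add[OF add_gauss.IH gaussian_span_mult_gauss[OF assms(1), of t c]]
    by (simp add: distrib_left)
qed

lemma gaussian_span_power:
  assumes "p \<in> gaussian_span"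
  shows "(\<lambda>x. p x ^ Suc n) \<in> gaussian_span"
proof (induction n)
  case (Suc n)
  then show ?case using gaussian_span_mult[OF assms] by (subst power_Suc) blast
qed (use assms in simp)

lemma gaussian_span_sum:
  assumes "finite S" "\<And>i. i \<in> S \<Longrightarrow> p i \<in> gaussian_span"
  shows "(\<lambda>x. \<Sum>i\<in>S. p i x) \<in> gaussian_span"
  using assms by (induction S) (auto intro: gaussian_span.zero gaussian_span_add)

lemma gauss_in_inversion_class:
  fixes t :: real
  assumes "t > 0"
  shows "(gauss t :: real ^ 'd \<Rightarrow> real) \<in> inversion_class"
proof -
  have "fourier (gauss t :: real ^ 'd \<Rightarrow> real) =
      (\<lambda>y. of_real ((1 / sqrt t) ^ CARD('d) * gauss (1 / t) y))"
    using assms by (simp add: fun_eq_iff fourier_gauss)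
  moreover have "integrable lborel (\<lambda>y :: real ^ 'd. (1 / sqrt t) ^ CARD('d) * gauss (1 / t) y)"
    using assms by (intro integrable_mult_right integrable_gauss) simp
  then have "integrable lborel (\<lambda>y :: real ^ 'd. complex_of_real ((1 / sqrt t) ^ CARD('d) * gauss (1 / t) y))"
    by (rule integrable_of_real)
  ultimately show ?thesis
    using assms by (simp only: inversion_class_def mem_Collect_eq)
      (simp add: continuous_on_gauss integrable_gauss, simp add: gauss_def)
qed

lemma fourier_real_gauss:
  "t > 0 \<Longrightarrow> fourier_real (gauss t :: real ^ 'd \<Rightarrow> real) y = (1 / sqrt t) ^ CARD('d) * gauss (1 / t) y"
  by (simp only: fourier_real_def fourier_gauss Re_complex_of_real)

lemma gaussian_span_subset_inversion_class: "gaussian_span \<subseteq> inversion_class"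
proof
  fix p :: "real ^ 'd \<Rightarrow> real" assume "p \<in> gaussian_span"
  then show "p \<in> inversion_class"
  proof induction
    case zero
    have "fourier (\<lambda>x :: real ^ 'd. 0) = (\<lambda>y. 0)"
      by (simp add: fun_eq_iff fourier_def)
    then show ?case by (simp add: inversion_class_def)
  next
    case (add_gauss p t c)
    then show ?case
      by (intro inversion_class_add inversion_class_cmult gauss_in_inversion_class)
  qed
qed

lemma fourier_real_gaussian_span:
  fixes p :: "real ^ 'd \<Rightarrow> real"
  assumes "p \<in> gaussian_span"
  shows "fourier_real p \<in> gaussian_span"
  using assms
proof induction
  case zero
  have "fourier_real (\<lambda>x :: real ^ 'd. 0) = (\<lambda>y. 0)"
    by (simp add: fun_eq_iff fourier_real_def fourier_def)
  then show ?case by (simp add: gaussian_span.zero)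
next
  case (add_gauss p t c)
  have "integrable lborel p" "integrable lborel (\<lambda>x :: real ^ 'd. c * gauss t x)"
    using add_gauss gaussian_span_subset_inversion_class
    by (auto intro: inversion_classD integrable_gauss)
  then have "fourier_real (\<lambda>x. p x + c * gauss t x) =
      (\<lambda>y. fourier_real p y + (c * (1 / sqrt t) ^ CARD('d)) * gauss (1 / t) y)"
    using add_gauss
    by (simp add: fun_eq_iff fourier_real_add fourier_real_cmult fourier_real_gauss mult.assoc)
  then show ?case
    using add_gauss by (simp only:) (intro gaussian_span.add_gauss, auto)
qed

lemma gauss_antimono: "s \<le> t \<Longrightarrow> gauss t x \<le> gauss s x"
  by (simp add: gauss_def mult_right_mono)

lemma gaussian_span_decay:
  assumes "p \<in> gaussian_span"
  shows "\<exists>C c. C \<ge> 0 \<and> c > 0 \<and> (\<forall>x. \<bar>p x\<bar> \<le> C * gauss c x)"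
  using assms
proof induction
  case zero
  show ?case by (rule exI[of _ 0], rule exI[of _ 1]) simp
next
  case (add_gauss p t b)
  then obtain C c where C: "C \<ge> 0" "c > 0" "\<And>x. \<bar>p x\<bar> \<le> C * gauss c x" by blast
  have "\<bar>p x + b * gauss t x\<bar> \<le> (C + \<bar>b\<bar>) * gauss (min c t) x" for x
  proof -
    have "\<bar>p x + b * gauss t x\<bar> \<le> C * gauss c x + \<bar>b\<bar> * gauss t x"
      using C(3)[of x] abs_triangle_ineq[of "p x" "b * gauss t x"]
      by (simp add: abs_mult gauss_pos less_imp_le)
    also have "\<dots> \<le> C * gauss (min c t) x + \<bar>b\<bar> * gauss (min c t) x"
      by (intro add_mono mult_left_mono gauss_antimono) (use C in auto)
    finally show ?thesis by (simp add: distrib_right)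
  qed
  then show ?case
    using C add_gauss by (intro exI[of _ "C + \<bar>b\<bar>"] exI[of _ "min c t"]) auto
qed

section \<open>A self-dual function that is positive on finitely many prescribed spheres\<close>

lemma AE_norm_neq: "AE x in lborel. norm (x :: 'a::euclidean_space) \<noteq> r"
proof -
  have "sphere (0 :: 'a) r \<in> null_sets lebesgue"
    using negligible_sphere by (simp flip: negligible_iff_null_sets)
  then have "sphere (0 :: 'a) r \<in> null_sets lborel"
    by (subst (asm) null_sets_completion_iff) auto
  then have "AE x in lborel. x \<notin> sphere (0 :: 'a) r"
    by (rule AE_not_in)
  then show ?thesis by simp
qed

text \<open>With the Gaussian \<open>w = 2 powr - (norm x / r)\<^sup>2\<close>, which takes the value 1/2 exactly on the sphere of
radius \<open>r\<close>, the function \<open>4 * w * (1 - w) = 1 - (2 * w - 1)\<^sup>2\<close> has all the properties; \<open>w\<^sup>2\<close> is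
again a Gaussian. It vanishes at the origin because \<open>w\<close> is 1 there.\<close>

lemma gaussian_bump:
  assumes "r > 0"
  obtains \<phi> :: "real ^ 'd \<Rightarrow> real" where
    "\<phi> \<in> gaussian_span" "\<phi> 0 = 0" "\<And>x. 0 \<le> \<phi> x" "\<And>x. \<phi> x \<le> 1" "\<And>x. \<phi> x = 1 \<longleftrightarrow> norm x = r"
proof
  define a where "a = ln 2 / (pi * r\<^sup>2)"
  let ?\<phi> = "\<lambda>x :: real ^ 'd. 4 * gauss a x + (- 4) * gauss (2 * a) x"
  have a: "a > 0"
    using assms by (simp add: a_def)
  have eq: "?\<phi> x = 1 - (2 * gauss a x - 1)\<^sup>2" "?\<phi> x = 4 * (gauss a x * (1 - gauss a x))" for x
    using gauss_mult[of a x a] by (simp_all add: power2_eq_square algebra_simps)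
  show "?\<phi> \<in> gaussian_span"
    using a by (intro gaussian_span.add_gauss gaussian_span_gauss) auto
  show "?\<phi> 0 = 0" by simp
  show "0 \<le> ?\<phi> x" for x
    unfolding eq(2) using gauss_pos[of a x] gauss_le_1[of a x] a
    by (intro mult_nonneg_nonneg) auto
  show "?\<phi> x \<le> 1" for x
    unfolding eq(1) by simp
  show "?\<phi> x = 1 \<longleftrightarrow> norm x = r" for x
  proof -
    have "?\<phi> x = 1 \<longleftrightarrow> gauss a x = inverse 2"
      unfolding eq(1) by auto
    also have "\<dots> \<longleftrightarrow> exp (- pi * a * (x \<bullet> x)) = exp (- ln 2)"
      by (simp add: gauss_def exp_minus)
    also have "\<dots> \<longleftrightarrow> x \<bullet> x = r\<^sup>2"
      unfolding exp_inj_iff using assms by (simp add: a_def field_simps)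
    also have "\<dots> \<longleftrightarrow> norm x = r"
      using assms by (simp add: norm_eq_square)
    finally show ?thesis .
  qed
qed

text \<open>High powers of the bump functions keep the value 1 on their spheres and tend to 0 elsewhere, hence
their integrals tend to 0 by dominated convergence. Powers remain in the Gaussian span.\<close>

lemma gaussian_bumps_small_integral:
  fixes Z :: "real set"
  assumes Z: "finite Z" "\<And>r. r \<in> Z \<Longrightarrow> r > 0" and "e > 0"
  obtains h :: "real ^ 'd \<Rightarrow> real" where
    "h \<in> gaussian_span" "h 0 = 0" "\<And>x. 0 \<le> h x" "\<And>x. norm x \<in> Z \<Longrightarrow> 1 \<le> h x"
    "(LINT x|lborel. h x) < e"
proof -
  have "\<forall>r\<in>Z. \<exists>\<phi> :: real ^ 'd \<Rightarrow> real. \<phi> \<in> gaussian_span \<and> \<phi> 0 = 0 \<and>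
      (\<forall>x. 0 \<le> \<phi> x \<and> \<phi> x \<le> 1 \<and> (\<phi> x = 1 \<longleftrightarrow> norm x = r))"
  proof
    fix r assume "r \<in> Z"
    from gaussian_bump[OF Z(2)[OF this]] obtain \<phi> :: "real ^ 'd \<Rightarrow> real" where
      "\<phi> \<in> gaussian_span" "\<phi> 0 = 0" "\<And>x. 0 \<le> \<phi> x" "\<And>x. \<phi> x \<le> 1" "\<And>x. \<phi> x = 1 \<longleftrightarrow> norm x = r"
      by metis
    then show "\<exists>\<phi> :: real ^ 'd \<Rightarrow> real. \<phi> \<in> gaussian_span \<and> \<phi> 0 = 0 \<and>
        (\<forall>x. 0 \<le> \<phi> x \<and> \<phi> x \<le> 1 \<and> (\<phi> x = 1 \<longleftrightarrow> norm x = r))"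
      by (intro exI[of _ \<phi>]) simp
  qed
  then obtain \<phi> :: "real \<Rightarrow> real ^ 'd \<Rightarrow> real" where \<phi>:
    "\<And>r. r \<in> Z \<Longrightarrow> \<phi> r \<in> gaussian_span" "\<And>r. r \<in> Z \<Longrightarrow> \<phi> r 0 = 0"
    "\<And>r x. r \<in> Z \<Longrightarrow> 0 \<le> \<phi> r x" "\<And>r x. r \<in> Z \<Longrightarrow> \<phi> r x \<le> 1"
    "\<And>r x. r \<in> Z \<Longrightarrow> \<phi> r x = 1 \<longleftrightarrow> norm x = r"
    by (subst (asm) bchoice_iff) blast
  have int: "integrable lborel (\<lambda>x. \<phi> r x ^ Suc n)" if "r \<in> Z" for r n
    using gaussian_span_power[OF \<phi>(1)[OF that]] gaussian_span_subset_inversion_class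
    by (blast intro: inversion_classD(3))
  have lim: "(\<lambda>n. LINT x|lborel. \<phi> r x ^ Suc n) \<longlonglongrightarrow> 0" if "r \<in> Z" for r
  proof -
    have "(\<lambda>n. LINT x|lborel. \<phi> r x ^ Suc n) \<longlonglongrightarrow> (LINT x|(lborel :: (real ^ 'd) measure). 0)"
    proof (rule integral_dominated_convergence[where w = "\<phi> r"])
      show "integrable lborel (\<phi> r)"
        using int[OF that, of 0] by simp
      show "(\<lambda>x. \<phi> r x ^ Suc n) \<in> borel_measurable lborel" for n
        using int[OF that] by (rule borel_measurable_integrable)
      show "AE x in lborel. norm (\<phi> r x ^ Suc n) \<le> \<phi> r x" for n
        using \<phi>(3,4)[OF that] by (simp add: abs_mult power_le_one mult_left_le)
      show "AE x in lborel. (\<lambda>n. \<phi> r x ^ Suc n) \<longlonglongrightarrow> 0"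
      proof (rule eventually_mono[OF AE_norm_neq[of r]])
        fix x :: "real ^ 'd" assume "norm x \<noteq> r"
        then have "\<phi> r x < 1"
          using \<phi>(4,5)[OF that] by (simp add: less_le)
        then show "(\<lambda>n. \<phi> r x ^ Suc n) \<longlonglongrightarrow> 0"
          using \<phi>(3)[OF that] by (intro LIMSEQ_Suc LIMSEQ_power_zero) simp
      qed
    qed simp
    then show ?thesis by simp
  qed
  have "(\<lambda>n. \<Sum>r\<in>Z. LINT x|lborel. \<phi> r x ^ Suc n) \<longlonglongrightarrow> (\<Sum>r\<in>Z. 0)"
    by (intro tendsto_sum lim)
  then have "(\<lambda>n. LINT x|lborel. (\<Sum>r\<in>Z. \<phi> r x ^ Suc n)) \<longlonglongrightarrow> (\<Sum>r\<in>Z. 0)"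
    using int by (subst Bochner_Integration.integral_sum)
  then have "\<forall>\<^sub>F n in sequentially. (LINT x|lborel. (\<Sum>r\<in>Z. \<phi> r x ^ Suc n)) < e"
    using \<open>e > 0\<close> by (intro order_tendstoD(2)[of _ "\<Sum>r\<in>Z. 0"]) auto
  then obtain n where n: "(LINT x|lborel. (\<Sum>r\<in>Z. \<phi> r x ^ Suc n)) < e"
    using eventually_happens by fastforce
  show thesis
  proof (rule that)
    show "(\<lambda>x. \<Sum>r\<in>Z. \<phi> r x ^ Suc n) \<in> gaussian_span"
      by (intro gaussian_span_sum gaussian_span_power \<phi> Z)
    show "(\<Sum>r\<in>Z. \<phi> r 0 ^ Suc n) = 0"
      using \<phi>(2) by simp
    show "0 \<le> (\<Sum>r\<in>Z. \<phi> r x ^ Suc n)" for x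
      by (intro sum_nonneg zero_le_power \<phi>)
    show "1 \<le> (\<Sum>r\<in>Z. \<phi> r x ^ Suc n)" if "norm x \<in> Z" for x
    proof -
      have "\<phi> (norm x) x = 1"
        using \<phi>(5) that by simp
      then show ?thesis
        using member_le_sum[OF that, of "\<lambda>r. \<phi> r x ^ Suc n"] Z(1) \<phi>(3) by simp
    qed
  qed (rule n)
qed

text \<open>Let \<open>h\<close> be at least 1 on the spheres and 0 at the origin, with integral below 1/8, so that its Fourier
transform is below 1/8 in absolute value everywhere. The sum of \<open>h\<close> and its transform is then positive
on the spheres and at most 1/8 at the origin. Subtracting half of a Gaussian and
half of its transform makes the value at the origin negative. The parameter 4 is chosen such that the
transform of the Gaussian is at most \<open>(1 / 2) ^ CARD('d) \<le> 1 / 2\<close>: the value on the spheres then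
stays above \<open>1 - 1 / 8 - 1 / 2 - 1 / 4 > 0\<close>.\<close>

lemma self_dual_positive_on_spheres:
  fixes Z :: "real set"
  assumes Z: "finite Z" "\<And>r. r \<in> Z \<Longrightarrow> r > 0"
  obtains q :: "real ^ 'd \<Rightarrow> real" where
    "q \<in> gaussian_span" "fourier_real q = q" "q 0 < 0" "\<And>x. norm x \<in> Z \<Longrightarrow> q x > 0"
proof -
  obtain h :: "real ^ 'd \<Rightarrow> real" where h:
    "h \<in> gaussian_span" "h 0 = 0" "\<And>x. 0 \<le> h x" "\<And>x. norm x \<in> Z \<Longrightarrow> 1 \<le> h x"
    "(LINT x|lborel. h x) < 1 / 8"
    using gaussian_bumps_small_integral[OF Z, of "1 / 8"] by auto
  define p where "p = (\<lambda>x. h x + (- 1 / 2) * gauss 4 x)"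
  have p: "p \<in> gaussian_span"
    unfolding p_def using h(1) by (intro gaussian_span.add_gauss) auto
  have p_eq: "p x = h x - 1 / 2 * gauss 4 x" for x
    by (simp add: p_def)
  have hint: "integrable lborel h"
    using h(1) gaussian_span_subset_inversion_class by (blast intro: inversion_classD(3))
  have hhat: "\<bar>fourier_real h x\<bar> < 1 / 8" for x
    using norm_fourier_le[OF hint, of x] abs_Re_le_cmod[of "fourier h x"] h(3,5)
    by (simp add: fourier_real_def)
  have phat: "fourier_real p x = fourier_real h x - 1 / 2 * ((1 / 2) ^ CARD('d) * gauss (1 / 4) x)" for x
  proof -
    have "fourier_real p x = fourier_real h x + fourier_real (\<lambda>x. (- 1 / 2) * gauss 4 x) x"
      unfolding p_def by (intro fourier_real_add hint integrable_mult_right integrable_gauss) simp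
    then show ?thesis
      by (simp only: fourier_real_cmult) (simp add: fourier_real_gauss)
  qed
  have d: "0 < (1 / 2 :: real) ^ CARD('d)" "(1 / 2 :: real) ^ CARD('d) \<le> 1 / 2"
    using power_decreasing[of 1 "CARD('d)" "1 / 2 :: real"] by (auto simp: Suc_le_eq)
  show thesis
  proof (rule that)
    show "(\<lambda>x. p x + fourier_real p x) \<in> gaussian_span"
      by (intro gaussian_span_add fourier_real_gaussian_span p)
    show "fourier_real (\<lambda>x. p x + fourier_real p x) = (\<lambda>x. p x + fourier_real p x)"
      using p gaussian_span_subset_inversion_class by (intro fourier_real_symmetrization) auto
    show "p 0 + fourier_real p 0 < 0"
      unfolding phat p_eq h(2) gauss_0 using hhat[of 0] d(1) by linarith
    show "p x + fourier_real p x > 0" if "norm x \<in> Z" for x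
    proof -
      have "(1 / 2) ^ CARD('d) * gauss (1 / 4) x \<le> 1 / 2 * 1"
        using d gauss_pos[of "1 / 4" x] by (intro mult_mono gauss_le_1) auto
      then show ?thesis
        using hhat[of x] h(4)[OF that] gauss_le_1[of 4 x] by (simp add: phat p_eq)
    qed
  qed
qed

text \<open>The self-dual function \<open>q\<close> of the previous lemma may oscillate at infinity, but it is bounded there by
a multiple of \<open>gauss c\<close> for some \<open>c > 0\<close>. A small multiple of the wider Gaussian \<open>gauss (c / 2)\<close> plus
its transform dominates it at infinity, is positive on the spheres, and by the strict inequality
\<open>q 0 < 0\<close> can be taken small enough to leave the value at the origin nonpositive.\<close>

lemma self_dual_perturbation:
  fixes Z :: "real set"
  assumes Z: "finite Z" "\<And>r. r \<in> Z \<Longrightarrow> r > 0"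
  obtains \<psi> :: "real ^ 'd \<Rightarrow> real" and M where
    "\<psi> \<in> inversion_class" "fourier_real \<psi> = \<psi>" "\<psi> 0 \<le> 0" "\<And>x. norm x \<in> Z \<Longrightarrow> \<psi> x > 0"
    "\<And>x. norm x \<ge> M \<Longrightarrow> \<psi> x \<ge> 0"
proof -
  obtain q :: "real ^ 'd \<Rightarrow> real" where q:
    "q \<in> gaussian_span" "fourier_real q = q" "q 0 < 0" "\<And>x. norm x \<in> Z \<Longrightarrow> q x > 0"
    using self_dual_positive_on_spheres[OF Z] by blast
  obtain C c where C: "C \<ge> 0" "c > 0" "\<And>x. \<bar>q x\<bar> \<le> C * gauss c x"
    using gaussian_span_decay[OF q(1)] by blast
  define s where "s = c / 2"
  have s: "s > 0" using C by (simp add: s_def)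
  define k where "k = (\<lambda>x :: real ^ 'd. gauss s x + fourier_real (gauss s) x)"
  have k_eq: "k x = gauss s x + (1 / sqrt s) ^ CARD('d) * gauss (1 / s) x" for x
    using s by (simp only: k_def fourier_real_gauss)
  have k_ge: "gauss s x \<le> k x" for x
    unfolding k_eq using s gauss_pos[of "1 / s" x] by simp
  have k_pos: "k x > 0" for x
    using k_ge[of x] gauss_pos[of s x] by linarith
  \<comment> \<open>This choice makes \<open>q + \<epsilon> * k\<close> vanish at the origin.\<close>
  define \<epsilon> where "\<epsilon> = - q 0 / k 0"
  have \<epsilon>: "\<epsilon> > 0"
    using q(3) k_pos[of 0] by (simp add: \<epsilon>_def divide_neg_pos)
  have W: "q \<in> inversion_class" "k \<in> inversion_class" "gauss s \<in> inversion_class"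
    using q(1) gaussian_span_subset_inversion_class s
    by (auto simp: k_def intro!: inversion_class_add gauss_in_inversion_class fourier_real_in_inversion_class)
  have k_dual: "fourier_real k = k"
    unfolding k_def by (rule fourier_real_symmetrization[OF W(3)])
  show thesis
  proof (rule that)
    let ?\<psi> = "\<lambda>x. q x + \<epsilon> * k x"
    show "?\<psi> \<in> inversion_class"
      by (intro inversion_class_add inversion_class_cmult W)
    show "fourier_real ?\<psi> = ?\<psi>"
      by (simp add: fun_eq_iff fourier_real_add fourier_real_cmult inversion_classD(3) W q(2) k_dual)
    show "?\<psi> 0 \<le> 0"
      using k_pos[of 0] by (simp add: \<epsilon>_def)
    show "?\<psi> x > 0" if "norm x \<in> Z" for x
      using q(4)[OF that] k_pos[of x] \<epsilon> by (simp add: add_pos_pos)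
    show "?\<psi> x \<ge> 0" if "norm x \<ge> sqrt (C / (\<epsilon> * pi * s))" for x
    proof -
      have "C / (\<epsilon> * pi * s) \<le> x \<bullet> x"
        using that by (simp add: norm_eq_sqrt_inner)
      then have "C \<le> \<epsilon> * (pi * s * (x \<bullet> x))"
        using \<epsilon> s by (simp add: pos_divide_le_eq mult_ac)
      also have "\<dots> \<le> \<epsilon> * exp (pi * s * (x \<bullet> x))"
        using \<epsilon> order_trans[OF _ exp_ge_add_one_self[of "pi * s * (x \<bullet> x)"]]
        by (intro mult_left_mono) auto
      finally have "C * gauss s x \<le> \<epsilon>"
        by (simp add: gauss_def exp_minus field_simps)
      then have "C * gauss s x * gauss s x \<le> \<epsilon> * gauss s x"
        using gauss_pos[of s x] by (intro mult_right_mono) auto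
      moreover have "C * gauss c x = C * gauss s x * gauss s x"
        using gauss_mult[of s x s] by (simp add: s_def)
      moreover have "\<epsilon> * gauss s x \<le> \<epsilon> * k x"
        using \<epsilon> k_ge by (intro mult_left_mono) auto
      ultimately show ?thesis
        using C(3)[of x] by linarith
    qed
  qed
qed

section \<open>Perturbing an extremizer\<close>

text \<open>The sum \<open>G\<close> of \<open>F\<close> and its Fourier transform is self-dual and nonnegative for \<open>norm x \<ge> R\<close>, and all
its zeros with \<open>norm x > R\<close> are zeros of \<open>F\<close>, hence lie on finitely many spheres. Let \<open>\<psi>\<close> be a
self-dual function that is positive on these spheres and on the sphere of radius \<open>R\<close>, nonnegative for
\<open>norm x \<ge> M\<close> and nonpositive at the origin. On the compact set \<open>C\<close> of the points with
\<open>R \<le> norm x \<le> M\<close> at which \<open>\<psi>\<close> is nonpositive, \<open>G\<close> is bounded below by a positive constant, so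
\<open>G + \<epsilon> * \<psi>\<close> is positive on the whole shell for small \<open>\<epsilon>\<close>. By compactness it remains positive
slightly inside the sphere of radius \<open>R\<close>, hence its sign radius is less than \<open>R\<close>.\<close>

lemma uncertainty_const_less_if_finitely_many_zeros:
  fixes F :: "real ^ 'd \<Rightarrow> real"
  assumes F: "F \<in> inversion_class" "F 0 \<le> 0" "fourier_real F 0 \<le> 0" and "R > 0"
    and nonneg: "\<And>x. norm x > R \<Longrightarrow> 0 \<le> F x" "\<And>x. norm x > R \<Longrightarrow> 0 \<le> fourier_real F x"
    and fin: "finite Z" "\<And>x. norm x > R \<Longrightarrow> F x = 0 \<Longrightarrow> norm x \<in> Z"
  shows "uncertainty_const TYPE('d) < ennreal R"
proof -
  define G where "G = (\<lambda>x. F x + fourier_real F x)"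
  have GW: "G \<in> inversion_class" and G_dual: "fourier_real G = G"
    unfolding G_def
    by (intro inversion_class_add fourier_real_in_inversion_class F fourier_real_symmetrization)+
  have G_cont: "continuous_on UNIV G"
    using GW by (rule inversion_classD)
  have G_far: "0 \<le> G x" if "norm x > R" for x
    using nonneg that by (simp add: G_def)
  have G_nonneg: "0 \<le> G x" if "norm x \<ge> R" for x
  proof (rule LIMSEQ_le_const)
    have "(\<lambda>n. (1 + 1 / real (Suc n)) *\<^sub>R x) \<longlonglongrightarrow> (1 + 0) *\<^sub>R x"
      by (intro tendsto_intros LIMSEQ_Suc[OF lim_1_over_n])
    then show "(\<lambda>n. G ((1 + 1 / real (Suc n)) *\<^sub>R x)) \<longlonglongrightarrow> G x"
      using G_cont by (intro isCont_tendsto_compose[of _ G]) (auto simp: continuous_on_eq_continuous_at)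
    have "G ((1 + 1 / real (Suc n)) *\<^sub>R x) \<ge> 0" for n
    proof (rule G_far)
      have "1 * norm x < (1 + 1 / real (Suc n)) * norm x"
        using that \<open>R > 0\<close> by (intro mult_strict_right_mono) auto
      then show "R < norm ((1 + 1 / real (Suc n)) *\<^sub>R x)"
        using that by simp
    qed
    then show "\<exists>N. \<forall>n\<ge>N. 0 \<le> G ((1 + 1 / real (Suc n)) *\<^sub>R x)"
      by blast
  qed
  obtain \<psi> :: "real ^ 'd \<Rightarrow> real" and M0 where \<psi>:
    "\<psi> \<in> inversion_class" "fourier_real \<psi> = \<psi>" "\<psi> 0 \<le> 0"
    "\<And>x. norm x \<in> insert R (Z \<inter> {0<..}) \<Longrightarrow> \<psi> x > 0" "\<And>x. norm x \<ge> M0 \<Longrightarrow> \<psi> x \<ge> 0"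
    using self_dual_perturbation[of "insert R (Z \<inter> {0<..})"] fin(1) \<open>R > 0\<close> by auto
  have \<psi>_cont: "continuous_on UNIV \<psi>"
    using \<psi>(1) by (rule inversion_classD)
  define M where "M = max M0 R"
  define C where "C = {x. R \<le> norm x \<and> norm x \<le> M \<and> \<psi> x \<le> 0}"
  have G_pos: "G x > 0" if "x \<in> C" for x
  proof -
    have x: "R \<le> norm x" "\<not> \<psi> x > 0"
      using that by (auto simp: C_def)
    then have "norm x \<noteq> R"
      using \<psi>(4)[of x] by auto
    then have "norm x > R"
      using x by simp
    moreover from this have "F x \<noteq> 0"
      using \<psi>(4)[of x] x(2) fin(2)[of x] \<open>R > 0\<close> by (auto simp del: zero_less_norm_iff)
    ultimately show ?thesis
      using nonneg[of x] by (simp add: G_def)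
  qed
  have "compact C"
  proof -
    have "closed C"
      unfolding C_def
      by (intro closed_Collect_conj closed_Collect_le continuous_intros \<psi>_cont)
    moreover have "C \<subseteq> cball 0 M"
      by (auto simp: C_def)
    ultimately show ?thesis
      using compact_Int_closed[of "cball 0 M" C] by (simp add: Int_absorb1)
  qed
  \<comment> \<open>On \<open>C\<close> the denominator \<open>1 - \<psi>\<close> is at least 1, and the minimum \<open>m\<close> of \<open>G / (1 - \<psi>)\<close> satisfies
    \<open>G + m * \<psi> \<ge> m\<close>.\<close>
  obtain \<epsilon> where \<epsilon>: "\<epsilon> > 0" "\<And>x. x \<in> C \<Longrightarrow> G x + \<epsilon> * \<psi> x > 0"
  proof (cases "C = {}")
    case True
    then show thesis using that[of 1] by simp
  next
    case False
    have denom: "1 - \<psi> x > 0" if "x \<in> C" for x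
      using that by (simp add: C_def)
    have "continuous_on C (\<lambda>x. G x / (1 - \<psi> x))"
      using denom
      by (intro continuous_intros continuous_on_subset[OF G_cont] continuous_on_subset[OF \<psi>_cont]) force+
    from continuous_attains_inf[OF \<open>compact C\<close> False this]
    obtain x0 where x0: "x0 \<in> C" "\<And>x. x \<in> C \<Longrightarrow> G x0 / (1 - \<psi> x0) \<le> G x / (1 - \<psi> x)" by blast
    define m where "m = G x0 / (1 - \<psi> x0)"
    have "m > 0"
      using G_pos denom x0(1) by (simp add: m_def)
    moreover have "G x + m * \<psi> x > 0" if "x \<in> C" for x
    proof -
      have "m * (1 - \<psi> x) \<le> G x"
        using x0(2)[OF that] denom[OF that] by (simp add: m_def[symmetric] pos_le_divide_eq)
      with \<open>m > 0\<close> show ?thesis by (simp add: right_diff_distrib)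
    qed
    ultimately show thesis by (rule that)
  qed
  define g where "g = (\<lambda>x. G x + \<epsilon> * \<psi> x)"
  have gW: "g \<in> inversion_class"
    unfolding g_def by (intro inversion_class_add inversion_class_cmult GW \<psi>)
  have g_dual: "fourier_real g = g"
    unfolding g_def
    by (simp add: fun_eq_iff fourier_real_add fourier_real_cmult inversion_classD(3) GW \<psi>(1,2) G_dual)
  have g_cont: "continuous_on UNIV g"
    using gW by (rule inversion_classD)
  have g0: "g 0 \<le> 0"
    using F(2,3) \<psi>(3) \<epsilon>(1) by (auto simp: g_def G_def intro!: add_nonpos_nonpos mult_nonneg_nonpos)
  have g_pos: "g x > 0" if "R \<le> norm x" "norm x \<le> M" for x
  proof (cases "\<psi> x \<le> 0")
    case True
    then show ?thesis
      using \<epsilon>(2)[of x] that by (simp add: C_def g_def)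
  next
    case False
    then show ?thesis
      using G_nonneg[OF that(1)] \<epsilon>(1) by (simp add: g_def add_nonneg_pos)
  qed
  have g_far: "g x \<ge> 0" if "norm x > M" for x
    using that G_nonneg[of x] \<psi>(5)[of x] \<epsilon>(1) by (simp add: g_def M_def)
  \<comment> \<open>The points of \<open>D\<close> lie strictly inside the sphere of radius \<open>R\<close>; the outermost of them bounds the
    sign radius of \<open>g\<close>.\<close>
  define D where "D = {x. norm x \<le> M \<and> g x \<le> 0}"
  have "compact D"
  proof -
    have "closed D"
      unfolding D_def by (intro closed_Collect_conj closed_Collect_le continuous_intros g_cont)
    moreover have "D \<subseteq> cball 0 M"
      by (auto simp: D_def)
    ultimately show ?thesis
      using compact_Int_closed[of "cball 0 M" D] by (simp add: Int_absorb1)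
  qed
  moreover have "D \<noteq> {}"
    using g0 \<open>R > 0\<close> by (auto simp: D_def M_def intro!: exI[of _ 0])
  ultimately obtain x0 where x0: "x0 \<in> D" "\<And>x. x \<in> D \<Longrightarrow> norm x \<le> norm x0"
    using continuous_attains_sup[of D norm] by (auto intro: continuous_intros)
  have "norm x0 < R"
    using x0(1) g_pos[of x0] by (force simp: D_def)
  \<comment> \<open>The maximum with \<open>R / 2\<close> keeps \<open>r\<close> positive when \<open>x0 = 0\<close>.\<close>
  define r where "r = max (norm x0) (R / 2)"
  have r: "0 < r" "r < R"
    using \<open>norm x0 < R\<close> \<open>R > 0\<close> by (auto simp: r_def)
  have "0 \<le> g x" if "norm x > r" for x
    using that g_far[of x] x0(2)[of x] by (cases "norm x \<le> M") (force simp: D_def r_def)+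
  moreover have "g \<in> uncertainty_class"
  proof -
    obtain x :: "real ^ 'd" where "norm x = R"
      using vector_choose_size[of R] \<open>R > 0\<close> by auto
    then have "g x \<noteq> 0"
      using g_pos[of x] by (simp add: M_def)
    then show ?thesis
      using gW g_dual g0 by (auto simp: uncertainty_class_iff)
  qed
  ultimately have "uncertainty_const TYPE('d) \<le> ennreal r"
    using g_dual r(1) by (intro uncertainty_const_le)
  also have "\<dots> < ennreal R"
    using r by (simp add: ennreal_less_iff)
  finally show ?thesis .
qed

text \<open>Any nonzero self-dual function with the right sign at the origin and at infinity bounds the constant.\<close>

lemma uncertainty_const_finite: "uncertainty_const TYPE('d::finite) < top"
proof -
  obtain \<psi> :: "real ^ 'd \<Rightarrow> real" and M where \<psi>:
    "\<psi> \<in> inversion_class" "fourier_real \<psi> = \<psi>" "\<psi> 0 \<le> 0" "\<And>x. norm x \<in> {1} \<Longrightarrow> \<psi> x > 0"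
    "\<And>x. norm x \<ge> M \<Longrightarrow> \<psi> x \<ge> 0"
    using self_dual_perturbation[of "{1}"] by auto
  obtain x :: "real ^ 'd" where "norm x = 1"
    using vector_choose_size[of 1] by auto
  then have "\<psi> x \<noteq> 0"
    using \<psi>(4)[of x] by simp
  then have "\<psi> \<in> uncertainty_class"
    using \<psi> by (auto simp: uncertainty_class_iff)
  then have "uncertainty_const TYPE('d) \<le> ennreal (max M 1)"
    using \<psi> by (intro uncertainty_const_le) auto
  then show ?thesis
    using ennreal_less_top le_less_trans by blast
qed

theorem theorem4:
  fixes f :: "real \<Rightarrow> real" and F :: "real ^ 'd \<Rightarrow> real"
  assumes radial: "\<And>x. F x = f (norm x)"
    and member: "F \<in> uncertainty_class"
    and extremal: "sign_radius F * sign_radius (fourier_real F) = (uncertainty_const TYPE('d))\<^sup>2"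
  shows "infinite {t::real. 0 \<le> t \<and> sign_radius F < ennreal t \<and> double_root f t}"
proof
  let ?S = "{t::real. 0 \<le> t \<and> sign_radius F < ennreal t \<and> double_root f t}"
  assume fin: "finite ?S"
  have W: "F \<in> inversion_class" and F0: "F 0 \<le> 0" "fourier_real F 0 \<le> 0"
    using member by (auto simp: uncertainty_class_iff)
  obtain A where A: "A \<ge> 0" "uncertainty_const TYPE('d) = ennreal A"
    using uncertainty_const_finite[where 'd = 'd] by (cases "uncertainty_const TYPE('d)") auto
  have prod: "sign_radius F * sign_radius (fourier_real F) = ennreal (A\<^sup>2)"
    using extremal A by (simp add: ennreal_power)
  have pos: "0 < sign_radius F" "0 < sign_radius (fourier_real F)"
    using member by (auto intro: sign_radius_pos uncertainty_class_fourier_real)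
  have "sign_radius F \<noteq> top" "sign_radius (fourier_real F) \<noteq> top"
    using prod pos by (auto simp: ennreal_top_mult ennreal_mult_top split: if_splits)
  then obtain a b where ab: "a > 0" "b > 0" "sign_radius F = ennreal a" "sign_radius (fourier_real F) = ennreal b"
    using pos by (cases "sign_radius F"; cases "sign_radius (fourier_real F)") auto
  have "a * b = A\<^sup>2"
    using prod ab by (simp flip: ennreal_mult)
  \<comment> \<open>The dilation by \<open>\<mu>\<close> gives \<open>F\<close> and its transform the same sign radius \<open>R\<close>, which is the uncertainty
    constant.\<close>
  define \<mu> where "\<mu> = sqrt (a / b)"
  define R where "R = sqrt (a * b)"
  have R: "R > 0" "R = A"
    using ab A(1) by (simp_all add: R_def) (simp add: \<open>a * b = A\<^sup>2\<close>)
  have \<mu>: "\<mu> > 0" "\<mu> * R = a" "R / \<mu> = b"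
    using ab by (auto simp: \<mu>_def R_def real_sqrt_divide real_sqrt_mult)
  define H where "H = (\<lambda>x. F (\<mu> *\<^sub>R x))"
  have Hhat: "fourier_real H y = (1 / \<mu>) ^ CARD('d) * fourier_real F ((1 / \<mu>) *\<^sub>R y)" for y
    unfolding H_def by (rule fourier_real_dilate[OF \<mu>(1)])
  have far: "a < norm (\<mu> *\<^sub>R x)" "b < norm ((1 / \<mu>) *\<^sub>R x)" if "norm x > R" for x :: "real ^ 'd"
    using that \<mu>(1) unfolding \<mu>(2)[symmetric] \<mu>(3)[symmetric] by (auto simp: divide_strict_right_mono)
  have F_nonneg: "0 \<le> F x" if "norm x > a" for x
    using nonneg_if_sign_radius_less[of F x] ab that by (simp add: ennreal_less_iff)
  have Fhat_nonneg: "0 \<le> fourier_real F x" if "norm x > b" for x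
    using nonneg_if_sign_radius_less[of "fourier_real F" x] ab that by (simp add: ennreal_less_iff)
  have f_nonneg: "0 \<le> f s" if "s > a" for s
  proof -
    obtain x :: "real ^ 'd" where "norm x = s"
      using vector_choose_size[of s] \<open>s > a\<close> ab by auto
    then show ?thesis
      using F_nonneg[of x] that radial by simp
  qed
  \<comment> \<open>Beyond its sign radius \<open>f\<close> is nonnegative, so each of its zeros there is a double root.\<close>
  have "norm x \<in> (\<lambda>t. t / \<mu>) ` ?S" if "norm x > R" "H x = 0" for x :: "real ^ 'd"
  proof (rule image_eqI)
    let ?t = "\<mu> * norm x"
    show "norm x = ?t / \<mu>"
      using \<mu>(1) by simp
    have t: "?t > a" "f ?t = 0"
      using far(1)[OF that(1)] that(2) \<mu>(1) by (auto simp: H_def radial)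
    have "\<forall>\<^sub>F s in nhds ?t. s > a"
      using t(1) by (intro eventually_nhds_in_open[of "{a<..}", simplified]) auto
    then have "\<forall>\<^sub>F s in nhds ?t. 0 \<le> f s"
      by (rule eventually_mono) (rule f_nonneg)
    then show "?t \<in> ?S"
      using t ab \<mu>(1) by (simp add: double_root_def ennreal_less_iff)
  qed
  moreover have "H \<in> inversion_class" "H 0 \<le> 0"
    unfolding H_def using \<mu>(1) W F0 by (auto intro: inversion_class_dilate)
  moreover have "fourier_real H 0 \<le> 0"
    unfolding Hhat using \<mu>(1) F0 by (simp add: mult_nonneg_nonpos)
  moreover have "0 \<le> H x" "0 \<le> fourier_real H x" if "norm x > R" for x
    using F_nonneg[OF far(1)[OF that]] Fhat_nonneg[OF far(2)[OF that]] \<mu>(1)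
    by (simp_all add: H_def Hhat[unfolded H_def])
  ultimately have "uncertainty_const TYPE('d) < ennreal R"
    using R(1) fin
    by (intro uncertainty_const_less_if_finitely_many_zeros[of H R "(\<lambda>t. t / \<mu>) ` ?S"] finite_imageI)
  then show False
    using A R by simp
qed

end
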